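(* There exists a constant $c>0$ (an absolute positive real number, independent of $k$, $s$, $X$ and $\mathcal F$) such that the following holds for all integers $k\ge 2$ and $s\ge 2$. Let $\mathcal F$ be a family of (distinct) subsets of a universal set $X$, each of cardinality at most $s$. If $$|\mathcal F|\ \ge\ \left(\sqrt{10}-2\right)^2\left[k\cdot\min\left(\frac{1}{\sqrt{10}-2},\ \frac{c}{\log\min(k,s)}\right)\right]^s s!,$$ then $\mathcal F$ includes a $k$-sunflower, i.e. there is a sub-family $\mathcal B\subset\mathcal F$ that is a sunflower of cardinality $k$.
   Context: A family $\mathcal B$ of sets is a sunflower with a core $Y$ if $U\cap U'=Y$ for every two different elements $U,U'\in\mathcal B$; equivalently, $U\cap U'=\bigcap_{V\in\mathcal B}V$ for all $U\neq U'$ in $\mathcal B$. The core may be empty. A $k$-sunflower is a sunflower of cardinality $k$, i.e. consisting of exactly $k$ distinct sets. Here $\log$ is the natural logarithm. *)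

theory Defs
  imports Complex_Main
begin

definition sunflower_with_core :: "'a set set \<Rightarrow> 'a set \<Rightarrow> bool" where
  "sunflower_with_core B Y \<longleftrightarrow> (\<forall>U\<in>B. \<forall>U'\<in>B. U \<noteq> U' \<longrightarrow> U \<inter> U' = Y)"

definition sunflower :: "'a set set \<Rightarrow> bool" where
  "sunflower B \<longleftrightarrow> (\<exists>Y. sunflower_with_core B Y)"

definition k_sunflower :: "nat \<Rightarrow> 'a set set \<Rightarrow> bool" where
  "k_sunflower k B \<longleftrightarrow> sunflower B \<and> finite B \<and> card B = k"

definition sunflower_threshold :: "real \<Rightarrow> nat \<Rightarrow> nat \<Rightarrow> real" where
  "sunflower_threshold c k s =
     (sqrt 10 - 2)\<^sup>2 * (real k * min (1 / (sqrt 10 - 2)) (c / ln (real (min k s)))) ^ s * fact s"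

text \<open>
  The type argument only names the type of the points. The universal set and the family
  may be infinite; since \<^const>\<open>card\<close> of an infinite set is 0, an infinite family is
  stated explicitly to satisfy every lower bound on its cardinality.
\<close>

definition sunflower_constant :: "'a itself \<Rightarrow> real \<Rightarrow> bool" where
  "sunflower_constant (_ :: 'a itself) c \<longleftrightarrow>
     (\<forall>k\<ge>2. \<forall>s\<ge>2. \<forall>(X :: 'a set) F.
        F \<subseteq> Pow X \<longrightarrow>
        (\<forall>U\<in>F. finite U \<and> card U \<le> s) \<longrightarrow>
        (infinite F \<or> real (card F) \<ge> sunflower_threshold c k s) \<longrightarrow>
        (\<exists>B\<subseteq>F. k_sunflower k B))"

text \<open>
  HOL cannot quantify over types below an existential quantifier, so in a statement of the form
  \<open>\<exists>c>0. sunflower_constant TYPE('a) c\<close> the witness could formally vary with \<open>'a\<close>. To make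
  the constant absolute, the theorem asserts that a positive constant exists for the type
  \<^typ>\<open>nat\<close>, and that every such constant also serves for an arbitrary type \<open>'a\<close> of points.
\<close>

end

theory Submission
  imports Defs "HOL-Library.FuncSet" "HOL-Library.Disjoint_Sets"
begin

text \<open>
  Write \<open>x = 1 / (sqrt 10 - 2)\<close>, so that \<open>6 x\<^sup>2 = 4 x + 1\<close>, and let \<open>f s\<close> be the largest size of
  an \<open>s\<close>-uniform family without a \<open>k\<close>-sunflower. Padding every set with private new points reduces
  the theorem to uniform families, where the two terms of the minimum have independent proofs.

  For the term \<open>x\<close>, take a maximum matching; it has at most \<open>k - 1\<close> members, and every set of the
  family meets its union. The sets meeting the union in a single point of a fixed member \<open>D\<close> are
  pairwise intersecting, since two disjoint ones could replace \<open>D\<close>; all other sets are counted at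
  least twice by the degrees of the points of the union. With \<open>g s = f s / (k ^ s * fact s)\<close> this
  gives \<open>g s \<le> 2/3 * g (s - 1) + 1/6 * g (s - 2)\<close> for \<open>k, s \<ge> 3\<close>, whose characteristic root is \<open>x\<close>.

  For the other term, since \<open>fact s \<ge> (s / e) ^ s\<close> and \<open>ln (min k s) \<le> ln s\<close>, it suffices that
  \<open>f s \<le> (C k s / ln s) ^ s\<close>. A larger family has a link in which every set \<open>Y\<close> is contained in at
  most a fraction \<open>R ^ - card Y\<close> of the members, with \<open>R = C k s / ln s\<close>. Colour the points randomly
  with \<open>4 k\<close> colours. Each of the \<open>2 k\<close> pairs of colours contains a member with probability at least
  \<open>1/2\<close>: the first colour leaves a fragment of size at most \<open>O(s / ln s)\<close> of most members, and the
  second colour covers one of these fragments. So some colouring yields \<open>k\<close> disjoint members.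
\<close>

section \<open>Sunflowers in links\<close>

lemma k_sunflower_image:
  assumes "k_sunflower k B" "inj_on f B"
    and "\<And>U V. U \<in> B \<Longrightarrow> V \<in> B \<Longrightarrow> U \<noteq> V \<Longrightarrow> f U \<inter> f V = g (U \<inter> V)"
  shows "k_sunflower k (f ` B)"
proof -
  obtain Y where "sunflower_with_core B Y"
    using assms(1) unfolding k_sunflower_def sunflower_def by blast
  then have Y: "U \<inter> V = Y" if "U \<in> B" "V \<in> B" "U \<noteq> V" for U V
    using that unfolding sunflower_with_core_def by simp
  have "W \<inter> W' = g Y" if W: "W \<in> f ` B" "W' \<in> f ` B" "W \<noteq> W'" for W W'
  proof -
    obtain U V where UV: "U \<in> B" "V \<in> B" "W = f U" "W' = f V" using W by blast
    with W(3) have "U \<noteq> V" by blast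
    then show ?thesis using assms(3) Y UV by simp
  qed
  then have "sunflower (f ` B)"
    unfolding sunflower_def sunflower_with_core_def by blast
  moreover have "finite (f ` B)" "card (f ` B) = k"
    using assms(1,2) unfolding k_sunflower_def by (simp_all add: card_image)
  ultimately show ?thesis unfolding k_sunflower_def by blast
qed

text \<open>Serves links, padding and the change of point type alike: \<open>g\<close> decodes what
  \<open>p\<close> encodes, hence is injective on the encoded family, and since it commutes with
  intersections it maps cores to cores.\<close>

lemma k_sunflower_pullback:
  assumes "B \<subseteq> p ` F" "k_sunflower k B"
    and inv: "\<And>U. U \<in> F \<Longrightarrow> g (p U) = U"
    and Int: "\<And>V W. g V \<inter> g W = g (V \<inter> W)"
  obtains B' where "B' \<subseteq> F" "k_sunflower k B'"
proof
  show "g ` B \<subseteq> F" using assms(1) inv by auto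
  have "inj_on g (p ` F)" using inv by (intro inj_on_inverseI[of _ p]) auto
  then have "inj_on g B" using assms(1) by (rule inj_on_subset)
  then show "k_sunflower k (g ` B)"
    by (rule k_sunflower_image[OF assms(2)]) (rule Int)
qed

lemma k_sunflower_disjoint:
  assumes "disjoint M" "finite M" "card M = k"
  shows "k_sunflower k M"
proof -
  have "sunflower_with_core M {}"
    using assms(1) unfolding sunflower_with_core_def disjoint_def by simp
  then show ?thesis using assms unfolding k_sunflower_def sunflower_def by blast
qed

definition sunflower_free :: "nat \<Rightarrow> 'a set set \<Rightarrow> bool" where
  "sunflower_free k F \<longleftrightarrow> \<not> (\<exists>B\<subseteq>F. k_sunflower k B)"

definition uniform_family :: "nat \<Rightarrow> 'a set set \<Rightarrow> bool" where
  "uniform_family s F \<longleftrightarrow> finite F \<and> (\<forall>U\<in>F. finite U \<and> card U = s)"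

lemma uniform_familyD:
  assumes "uniform_family s F"
  shows "finite F" "U \<in> F \<Longrightarrow> finite U" "U \<in> F \<Longrightarrow> card U = s"
  using assms unfolding uniform_family_def by auto

definition link :: "'a set \<Rightarrow> 'a set set \<Rightarrow> 'a set set" where
  "link Z F = (\<lambda>U. U - Z) ` {U \<in> F. Z \<subseteq> U}"

lemma card_link: "card (link Z F) = card {U \<in> F. Z \<subseteq> U}"
  unfolding link_def by (rule card_image) (auto simp: inj_on_def)

lemma sunflower_free_link:
  assumes "sunflower_free k F"
  shows "sunflower_free k (link Z F)"
  unfolding sunflower_free_def
proof
  assume "\<exists>B\<subseteq>link Z F. k_sunflower k B"
  then obtain B where "B \<subseteq> (\<lambda>U. U - Z) ` {U \<in> F. Z \<subseteq> U}" "k_sunflower k B"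
    unfolding link_def by blast
  then obtain B' where "B' \<subseteq> {U \<in> F. Z \<subseteq> U}" "k_sunflower k B'"
    by (rule k_sunflower_pullback[where g = "\<lambda>V. V \<union> Z"]) auto
  then show False using assms unfolding sunflower_free_def by blast
qed

lemma uniform_family_link:
  assumes "uniform_family s F" "finite Z"
  shows "uniform_family (s - card Z) (link Z F)"
  using assms unfolding uniform_family_def link_def by (auto simp: card_Diff_subset)

section \<open>The recursion from a maximum matching\<close>

text \<open>\<open>k\<close> disjoint sets already form a sunflower with empty core, which caps
  every matching at \<open>k - 1\<close> members.\<close>

lemma ex_maximum_matching:
  assumes "uniform_family s F" "sunflower_free k F" "k \<ge> 1"
  obtains M where "M \<subseteq> F" "disjoint M" "card M \<le> k - 1"
    "\<And>M'. M' \<subseteq> F \<Longrightarrow> disjoint M' \<Longrightarrow> card M' \<le> card M"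
proof -
  have fin: "finite F" using assms(1) by (rule uniform_familyD)
  define C where "C = {M. M \<subseteq> F \<and> disjoint M}"
  have C: "finite C" "{} \<in> C" using fin unfolding C_def by auto
  then have "Max (card ` C) \<in> card ` C" by (intro Max_in) auto
  then obtain M where M: "M \<in> C" "card M = Max (card ` C)" by auto
  have max: "card M' \<le> card M" if "M' \<in> C" for M'
    using M(2) C that by simp
  have "card M \<le> k - 1"
  proof (rule ccontr)
    assume "\<not> card M \<le> k - 1"
    then have "k \<le> card M" by simp
    then obtain B where B: "B \<subseteq> M" "card B = k" "finite B"
      by (meson obtain_subset_with_card_n)
    moreover have "disjoint B" using M(1) B(1) unfolding C_def disjoint_def by blast
    ultimately have "k_sunflower k B" by (intro k_sunflower_disjoint)
    then show False using assms(2) M(1) B(1) unfolding C_def sunflower_free_def by blast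
  qed
  then show thesis using that M(1) max unfolding C_def by blast
qed

lemma sum_degrees:
  assumes "finite F" "finite B"
  shows "(\<Sum>v\<in>B. card {U \<in> F. v \<in> U}) = (\<Sum>U\<in>F. card (U \<inter> B))"
  using sum_multicount_gen[OF assms(2,1), of "\<lambda>v U. v \<in> U" "\<lambda>U. card (U \<inter> B)"]
  by (simp add: Int_def conj_commute)

text \<open>\<open>N1\<close> and \<open>N2\<close> bound degrees and codegrees. The first bound
  counts \<open>F\<close> by the degrees on the union \<open>B\<close> of a maximum matching; the
  second counts every set twice, with a surcharge for the sets that meet \<open>B\<close> in a
  single point.\<close>

lemma matching_step:
  fixes N1 N2 :: real
  assumes uni: "uniform_family s F" and free: "sunflower_free k F" and "k \<ge> 1" "s \<ge> 1"
    and N1: "\<And>v. card {U \<in> F. v \<in> U} \<le> N1"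
    and N2: "\<And>v w. v \<noteq> w \<Longrightarrow> card {U \<in> F. v \<in> U \<and> w \<in> U} \<le> N2"
    and "N2 \<ge> 0"
  shows "card F \<le> real (k - 1) * (s * N1)"
    and "2 * card F \<le> real (k - 1) * (s * N1 + max N1 (real s * real (s - 1) * N2))"
proof -
  note F = uniform_familyD[OF uni]
  obtain M where M: "M \<subseteq> F" "disjoint M" "card M \<le> k - 1"
    and max: "\<And>M'. M' \<subseteq> F \<Longrightarrow> disjoint M' \<Longrightarrow> card M' \<le> card M"
    using ex_maximum_matching[OF uni free \<open>k \<ge> 1\<close>] by blast
  have finM: "finite M" using M(1) F(1) finite_subset by blast
  define B where "B = \<Union>M"
  have finB: "finite B" unfolding B_def using finM M(1) F(2) by blast
  have cBM: "card B \<le> card M * s"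
  proof -
    have "card B \<le> (\<Sum>D\<in>M. card D)" unfolding B_def using card_UN_le[OF finM, of id] by simp
    also have "\<dots> = card M * s" using F(3) M(1) by (simp add: subset_iff)
    finally show ?thesis .
  qed
  then have cB: "card B \<le> (k - 1) * s" using M(3) by (meson le_trans mult_le_mono1)
  \<comment> \<open>Any one degree, here that of the point \<open>undefined\<close>, shows
    this.\<close>
  have N1_0: "N1 \<ge> 0" using N1[of undefined] by (meson of_nat_0_le_iff order_trans)
  have hit: "card (U \<inter> B) \<ge> 1" if U: "U \<in> F" for U
  proof (rule ccontr)
    assume "\<not> card (U \<inter> B) \<ge> 1"
    then have dis: "U \<inter> B = {}" using finB by (simp add: not_le)
    \<comment> \<open>An empty \<open>U\<close> could already belong to \<open>M\<close>;
      \<open>s \<ge> 1\<close> excludes this, so inserting \<open>U\<close> really enlarges the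
      matching.\<close>
    have "U \<noteq> {}" using F(3)[OF U] \<open>s \<ge> 1\<close> by auto
    then have "U \<notin> M" using dis unfolding B_def by blast
    moreover have "disjoint (insert U M)"
      using M(2) dis unfolding B_def disjoint_def by blast
    ultimately show False
      using max[of "insert U M"] M(1) U finM by simp
  qed
  have deg: "(\<Sum>U\<in>F. real (card (U \<inter> B))) \<le> real (k - 1) * (s * N1)"
  proof -
    have "(\<Sum>U\<in>F. real (card (U \<inter> B))) = real (\<Sum>v\<in>B. card {U \<in> F. v \<in> U})"
      unfolding sum_degrees[OF F(1) finB] by simp
    also have "\<dots> \<le> card B * N1" using N1 sum_bounded_above[of B "\<lambda>v. real (card {U \<in> F. v \<in> U})" N1] by simp
    also have "\<dots> \<le> real ((k - 1) * s) * N1"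
      using cB N1_0 by (intro mult_right_mono) (auto simp del: of_nat_mult)
    finally show ?thesis by (simp add: mult.assoc)
  qed
  have "real (card F) = (\<Sum>U\<in>F. 1)" by simp
  also have "\<dots> \<le> (\<Sum>U\<in>F. real (card (U \<inter> B)))" using hit by (intro sum_mono) simp
  finally show "card F \<le> real (k - 1) * (s * N1)" using deg by linarith

  define F1 where "F1 D = {U \<in> F. \<exists>v\<in>D. U \<inter> B = {v}}" for D
  have F1_intersecting: "U \<inter> U' \<noteq> {}" if D: "D \<in> M" and U: "U \<in> F1 D" "U' \<in> F1 D" for D U U'
  proof
    assume dis: "U \<inter> U' = {}"
    define M' where "M' = insert U (insert U' (M - {D}))"
    have sub: "U \<in> F" "U' \<in> F" using U unfolding F1_def by auto
    obtain v v' where v: "v \<in> D" "U \<inter> B = {v}" "v' \<in> D" "U' \<inter> B = {v'}"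
      using U unfolding F1_def by auto
    have disD: "E \<inter> D = {}" if "E \<in> M - {D}" for E
      using that D M(2) unfolding disjoint_def by blast
    have EB: "E \<subseteq> B" if "E \<in> M - {D}" for E using that unfolding B_def by blast
    have UE: "U \<inter> E = {}" "U' \<inter> E = {}" if "E \<in> M - {D}" for E
    proof -
      have "U \<inter> E = U \<inter> B \<inter> E" "U' \<inter> E = U' \<inter> B \<inter> E" using EB[OF that] by auto
      then show "U \<inter> E = {}" "U' \<inter> E = {}" using disD[OF that] v by auto
    qed
    have "disjoint M'"
      using M(2) dis UE unfolding M'_def
      by (auto simp: pairwise_insert pairwise_subset disjnt_def Int_commute)
    moreover have "U \<noteq> {}" "U' \<noteq> {}" using v by blast+
    then have new: "U \<noteq> U'" "U \<notin> M - {D}" "U' \<notin> M - {D}"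
      using dis UE(1)[of U] UE(2)[of U'] Int_absorb[of U] Int_absorb[of U'] by metis+
    then have "card M' = Suc (card M)"
    proof -
      have "card (M - {D}) = card M - 1" "card M > 0"
        using finM D by (auto simp: card_gt_0_iff)
      then show ?thesis unfolding M'_def using finM new
        by (subst card_insert_disjoint; simp del: Diff_iff card_Diff_insert)
    qed
    moreover have "M' \<subseteq> F" using M(1) sub unfolding M'_def by blast
    ultimately show False using max[of M'] by simp
  qed
  have F1_card: "real (card (F1 D)) \<le> max N1 (real s * real (s - 1) * N2)" if D: "D \<in> M" for D
  \<comment> \<open>Either one point lies in all sets of \<open>F1 D\<close>, or every
    \<open>v\<close> in \<open>D\<close> is avoided by some \<open>U'\<close> in
    \<open>F1 D\<close>. In the second case each set of \<open>F1 D\<close> through \<open>v\<close>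
    meets \<open>U'\<close> in one of the \<open>s - 1\<close> points of \<open>U'\<close> outside
    \<open>B\<close>, where the codegree bound applies.\<close>
  proof (cases "\<exists>v. F1 D \<subseteq> {U \<in> F. v \<in> U}")
    case True
    then obtain v where v: "F1 D \<subseteq> {U \<in> F. v \<in> U}" by blast
    have "card (F1 D) \<le> card {U \<in> F. v \<in> U}" using v F(1) by (intro card_mono) auto
    then show ?thesis using N1[of v] by linarith
  next
    case False
    have DF: "D \<in> F" using D M(1) by blast
    have star: "real (card {U \<in> F1 D. U \<inter> B = {v}}) \<le> real (s - 1) * N2" if v: "v \<in> D" for v
    proof -
      obtain U' where U': "U' \<in> F1 D" "v \<notin> U'" using False unfolding F1_def by blast
      then obtain v' where v': "U' \<in> F" "U' \<inter> B = {v'}" "v' \<noteq> v" unfolding F1_def by blast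
      have cU': "card (U' - B) = s - 1"
        using card_Diff_subset_Int[of U' B] v' F(2,3) finB by simp
      have "{U \<in> F1 D. U \<inter> B = {v}} \<subseteq> (\<Union>w\<in>U' - B. {U \<in> F. v \<in> U \<and> w \<in> U})"
      proof
        fix U assume U: "U \<in> {U \<in> F1 D. U \<inter> B = {v}}"
        then obtain w where w: "w \<in> U" "w \<in> U'" using F1_intersecting[OF D _ U'(1)] by blast
        have "U \<inter> B = {v}" "U \<in> F" using U unfolding F1_def by auto
        moreover from this have "w \<notin> B" using w v'(2,3) by (metis IntI singletonD)
        ultimately show "U \<in> (\<Union>w\<in>U' - B. {U \<in> F. v \<in> U \<and> w \<in> U})"
          using w by auto
      qed
      then have "card {U \<in> F1 D. U \<inter> B = {v}} \<le> card (\<Union>w\<in>U' - B. {U \<in> F. v \<in> U \<and> w \<in> U})"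
        using F(1,2) v'(1) by (intro card_mono) auto
      then have "card {U \<in> F1 D. U \<inter> B = {v}} \<le> (\<Sum>w\<in>U' - B. card {U \<in> F. v \<in> U \<and> w \<in> U})"
        using card_UN_le[of "U' - B" "\<lambda>w. {U \<in> F. v \<in> U \<and> w \<in> U}"] F(2) v'(1)
        by (meson finite_Diff le_trans)
      then have "real (card {U \<in> F1 D. U \<inter> B = {v}}) \<le> (\<Sum>w\<in>U' - B. real (card {U \<in> F. v \<in> U \<and> w \<in> U}))"
        unfolding of_nat_sum[symmetric] of_nat_le_iff .
      also have "\<dots> \<le> card (U' - B) * N2"
      proof -
        have "v \<in> B" using v D unfolding B_def by blast
        then have "real (card {U \<in> F. v \<in> U \<and> w \<in> U}) \<le> N2" if "w \<in> U' - B" for w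
          using that by (intro N2) auto
        then show ?thesis by (rule sum_bounded_above)
      qed
      finally show ?thesis using cU' by simp
    qed
    have finD: "finite D" using F(2) DF by blast
    have "F1 D = (\<Union>v\<in>D. {U \<in> F1 D. U \<inter> B = {v}})" unfolding F1_def by blast
    then have "card (F1 D) \<le> (\<Sum>v\<in>D. card {U \<in> F1 D. U \<inter> B = {v}})"
      using card_UN_le[OF finD, of "\<lambda>v. {U \<in> F1 D. U \<inter> B = {v}}"] by simp
    then have "real (card (F1 D)) \<le> (\<Sum>v\<in>D. real (card {U \<in> F1 D. U \<inter> B = {v}}))"
      unfolding of_nat_sum[symmetric] of_nat_le_iff .
    also have "\<dots> \<le> card D * (real (s - 1) * N2)" using star by (rule sum_bounded_above)
    finally show ?thesis using F(3) DF by (simp add: mult.assoc)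
  qed
  \<comment> \<open>A set meeting \<open>B\<close> in two or more points has weight at least 2 by
    itself; a set meeting it once receives the extra 1.\<close>
  have "2 * real (card F) \<le> (\<Sum>U\<in>F. real (card (U \<inter> B)) + (if card (U \<inter> B) = 1 then 1 else 0))"
  proof -
    have "2 * real (card F) = (\<Sum>U\<in>F. 2)" by simp
    also have "\<dots> \<le> (\<Sum>U\<in>F. real (card (U \<inter> B)) + (if card (U \<inter> B) = 1 then 1 else 0))"
    proof (rule sum_mono)
      fix U assume "U \<in> F"
      then show "2 \<le> real (card (U \<inter> B)) + (if card (U \<inter> B) = 1 then 1 else 0)"
        using hit[of U] by (cases "card (U \<inter> B) = 1") auto
    qed
    finally show ?thesis .
  qed
  also have "\<dots> = (\<Sum>U\<in>F. real (card (U \<inter> B))) + card {U \<in> F. card (U \<inter> B) = 1}"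
    using F(1) by (simp add: sum.distrib sum.If_cases Int_def)
  also have "real (card {U \<in> F. card (U \<inter> B) = 1}) \<le> real (k - 1) * max N1 (real s * real (s - 1) * N2)"
  proof -
    have "{U \<in> F. card (U \<inter> B) = 1} \<subseteq> (\<Union>D\<in>M. F1 D)"
      unfolding F1_def B_def by (auto simp: card_1_singleton_iff)
    then have "card {U \<in> F. card (U \<inter> B) = 1} \<le> card (\<Union>D\<in>M. F1 D)"
      using finM F(1) by (intro card_mono) (auto simp: F1_def)
    also have "\<dots> \<le> (\<Sum>D\<in>M. card (F1 D))" by (rule card_UN_le[OF finM])
    finally have "real (card {U \<in> F. card (U \<inter> B) = 1}) \<le> (\<Sum>D\<in>M. real (card (F1 D)))"
      unfolding of_nat_sum[symmetric] of_nat_le_iff .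
    also have "\<dots> \<le> card M * max N1 (real s * real (s - 1) * N2)"
      using F1_card by (rule sum_bounded_above)
    also have "\<dots> \<le> real (k - 1) * max N1 (real s * real (s - 1) * N2)"
      using M(3) N1_0 by (intro mult_right_mono) auto
    finally show ?thesis .
  qed
  finally show "2 * card F \<le> real (k - 1) * (s * N1 + max N1 (real s * real (s - 1) * N2))"
    using deg by (simp add: distrib_left)
qed

section \<open>Solving the recursion for uniform families\<close>

lemma card_containing_less:
  fixes \<phi> :: "nat \<Rightarrow> real" and F :: "'a set set"
  assumes "uniform_family s F" "sunflower_free k F" "finite Z"
    and "\<And>G :: 'a set set. uniform_family (s - card Z) G \<Longrightarrow> sunflower_free k G \<Longrightarrow> card G < \<phi> (s - card Z)"
  shows "card {U \<in> F. Z \<subseteq> U} < \<phi> (s - card Z)"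
  using assms(4)[of "link Z F"] uniform_family_link[OF assms(1,3)] sunflower_free_link[OF assms(2)]
  by (simp add: card_link)

lemma card_containing_le_1:
  assumes "uniform_family 1 F"
  shows "card {U \<in> F. v \<in> U} \<le> 1"
proof -
  have "{U \<in> F. v \<in> U} \<subseteq> {{v}}"
  proof
    fix U assume U: "U \<in> {U \<in> F. v \<in> U}"
    then have "card U = 1" using assms unfolding uniform_family_def by blast
    then obtain w where "U = {w}" by (rule card_1_singletonE)
    then show "U \<in> {{v}}" using U by simp
  qed
  then show ?thesis using card_mono[of "{{v}}" "{U \<in> F. v \<in> U}"] by simp
qed

text \<open>For \<open>s \<ge> 3\<close> the two-term recursion closes because
  \<open>6 * x\<^sup>2 = 4 * x + 1\<close> is its characteristic equation in the worst case
  \<open>k = s = 3\<close>. The factor \<open>1 / x\<^sup>2\<close> makes the bound exactly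
  \<open>2 * k\<^sup>2\<close> at \<open>s = 2\<close>.\<close>

lemma elementary_bound:
  fixes x :: real and F :: "'a set set"
  assumes k: "k \<ge> 3" and x: "x > 0" "6 * x\<^sup>2 = 4 * x + 1"
    and "uniform_family s F" "sunflower_free k F"
  shows "card F < (k * x) ^ s * fact s / x\<^sup>2"
  using assms(4,5)
proof (induction s arbitrary: F rule: less_induct)
  case (less s)
  define \<phi> :: "nat \<Rightarrow> real" where "\<phi> n = (k * x) ^ n * fact n / x\<^sup>2" for n
  have pos: "\<phi> n > 0" for n unfolding \<phi>_def using k x by simp
  note free = less.prems(2) and uni = less.prems(1)
  have IH: "card G < \<phi> n" if "n < s" "uniform_family n G" "sunflower_free k G" for n and G :: "'a set set"
    using less.IH[OF that] unfolding \<phi>_def .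
  have x1: "x < 1"
  proof (rule ccontr)
    assume "\<not> x < 1"
    then have "x * 1 \<le> x * x" using x(1) by (intro mult_left_mono) auto
    then show False using x(2) \<open>\<not> x < 1\<close> unfolding power2_eq_square by linarith
  qed
  have x2: "x\<^sup>2 < 1" using x x1 by (simp add: power_less_one_iff)
  have N1: "card {U \<in> F. v \<in> U} < \<phi> (s - 1)" if "s \<ge> 1" for v
    using card_containing_less[OF uni free, of "{v}" \<phi>, OF _ IH] that by simp
  have N2: "card {U \<in> F. v \<in> U \<and> w \<in> U} < \<phi> (s - 2)" if "s \<ge> 2" "v \<noteq> w" for v w
    using card_containing_less[OF uni free, of "{v, w}" \<phi>, OF _ IH] that by (simp add: numeral_2_eq_2)
  have base: "card F < \<phi> 0" if "s = 0"
  proof -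
    have "F \<subseteq> {{}}" using uni that unfolding uniform_family_def by auto
    then have "card F \<le> card {{} :: 'a set}" by (intro card_mono) auto
    moreover have "1 < \<phi> 0" unfolding \<phi>_def using x x2 by simp
    ultimately show ?thesis by simp
  qed
  \<comment> \<open>For \<open>s = 2\<close> the factor \<open>(s + 1) / s\<close> would exceed
    \<open>4/3\<close>, so the recursion starts at 3 and the smaller cases are counted
    directly.\<close>
  consider "s = 0" | "s = 1" | "s = 2" | "s \<ge> 3" by linarith
  then have "card F < \<phi> s"
  proof cases
    case 1
    then show ?thesis using base by simp
  next
    case 2
    have deg1: "real (card {U \<in> F. v \<in> U}) \<le> 1" for v
      using card_containing_le_1[of F v] uni 2 by simp
    have "card F \<le> real (k - 1) * (real s * 1)"
    proof (rule matching_step(1)[OF uni free _ _ deg1, of "card F"])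
      show "real (card {U \<in> F. v \<in> U \<and> w \<in> U}) \<le> card F" for v w
        using uniform_familyD(1)[OF uni] by (simp add: card_mono)
    qed (use k 2 in auto)
    also have "\<dots> < k" using k 2 by simp
    also have "real k \<le> k / x" using x(1) x1 by (simp add: le_divide_eq mult_left_le)
    also have "\<dots> = \<phi> s" unfolding \<phi>_def 2 using x by (simp add: field_simps power2_eq_square)
    finally show ?thesis .
  next
    case 3
    have deg1: "real (card {U \<in> F. v \<in> U}) \<le> k - 1" for v
    proof -
      have U1: "uniform_family 1 (link {v} F)"
        using uniform_family_link[OF uni, of "{v}"] 3 by simp
      have link1: "real (card {U \<in> link {v} F. w \<in> U}) \<le> 1" for w
        using card_containing_le_1[OF U1, of w] by simp
      have "card (link {v} F) \<le> real (k - 1) * (real 1 * 1)"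
      proof (rule matching_step(1)[OF U1 sunflower_free_link[OF free] _ _ link1, of "card (link {v} F)"])
        show "real (card {U \<in> link {v} F. a \<in> U \<and> w \<in> U}) \<le> card (link {v} F)" for a w
          using uniform_familyD(1)[OF U1] by (simp add: card_mono)
      qed (use k in auto)
      then show ?thesis by (simp add: card_link)
    qed
    have "card F \<le> real (k - 1) * (s * real (k - 1))"
    proof (rule matching_step(1)[OF uni free _ _ deg1, of "card F"])
      show "real (card {U \<in> F. v \<in> U \<and> w \<in> U}) \<le> card F" for v w
        using uniform_familyD(1)[OF uni] by (simp add: card_mono)
    qed (use k 3 in auto)
    also have "\<dots> < real k * (real s * real k)" unfolding 3 using k by (cases k) (auto simp: algebra_simps)
    also have "\<dots> = \<phi> s" unfolding \<phi>_def 3 using x by (simp add: field_simps power2_eq_square)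
    finally show ?thesis .
  next
    case 4
    define n where "n = s - 3"
    have s: "s = n + 3" using 4 unfolding n_def by simp
    define R where "R = real s * \<phi> (s - 1) + max (\<phi> (s - 1)) (real s * real (s - 1) * \<phi> (s - 2))"
    have "2 * card F \<le> real (k - 1) * R" unfolding R_def
      by (rule matching_step(2)[OF uni free])
         (use k 4 N1 N2 pos in \<open>auto intro: less_imp_le\<close>)
    also have "\<dots> < k * R"
    proof (rule mult_strict_right_mono)
      show "R > 0" unfolding R_def using pos[of "s - 1"] 4 by (intro add_pos_nonneg) auto
    qed (use k in auto)
    \<comment> \<open>Bounding the maximum by the sum makes the recursion linear.\<close>
    also have "\<dots> \<le> k * (real (s + 1) * \<phi> (s - 1) + real s * real (s - 1) * \<phi> (s - 2))"
    proof (rule mult_left_mono)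
      show "R \<le> real (s + 1) * \<phi> (s - 1) + real s * real (s - 1) * \<phi> (s - 2)"
        unfolding R_def using pos[of "s - 1"] pos[of "s - 2"] by (auto simp: max_def algebra_simps)
    qed simp
    also have "\<dots> = (k * x) ^ s * fact s / x ^ 4 * (real (s + 1) / s * x + 1 / k)"
    proof -
      define f where "f = (fact (n + 1) :: real)"
      have f: "fact (s - 2) = f" "fact (s - 1) = real (n + 2) * f" "fact s = real (n + 3) * real (n + 2) * f"
        unfolding f_def s by (simp_all add: numeral_eq_Suc algebra_simps)
      define a where "a = (k * x) ^ (n + 1)"
      have p: "(k * x) ^ (s - 2) = a" "(k * x) ^ (s - 1) = (k * x) * a" "(k * x) ^ s = (k * x) ^ 2 * a"
        unfolding a_def s by (simp_all add: numeral_eq_Suc algebra_simps)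
      have q: "real (s + 1) = real s + 1" "real (n + 2) = real s - 1" "real (s - 1) = real s - 1"
        "real (n + 3) = real s"
        unfolding s by simp_all
      have "real k * ((real s + 1) * (real k * x * a * ((real s - 1) * f) / x\<^sup>2) + real s * (real s - 1) * (a * f / x\<^sup>2))
        = (real k * x)\<^sup>2 * a * (real s * (real s - 1) * f) / x ^ 4 * ((real s + 1) / real s * x + 1 / real k)"
        using k x(1) 4 by (simp add: power2_eq_square power4_eq_xxxx field_simps)
      then show ?thesis unfolding \<phi>_def f p q .
    qed
    also have "\<dots> \<le> (k * x) ^ s * fact s / x ^ 4 * (4/3 * x + 1/3)"
    proof (rule mult_left_mono)
      have "real (s + 1) / s \<le> 4/3" using 4 by (simp add: field_simps)
      then have "real (s + 1) / s * x \<le> 4/3 * x" using x by (intro mult_right_mono) auto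
      moreover have "1 / real k \<le> 1/3" using k by (simp add: field_simps)
      ultimately show "real (s + 1) / s * x + 1 / k \<le> 4/3 * x + 1/3" by linarith
    qed (use k x in simp)
    also have "4/3 * x + 1/3 = 2 * x\<^sup>2" using x(2) by simp
    also have "(k * x) ^ s * fact s / x ^ 4 * (2 * x\<^sup>2) = 2 * \<phi> s"
      unfolding \<phi>_def using x(1) by (simp add: field_simps power2_eq_square power4_eq_xxxx)
    finally show ?thesis by simp
  qed
  then show ?case unfolding \<phi>_def .
qed

section \<open>Fragments and random colourings\<close>

text \<open>The minimum fragment of Park and Pham: \<open>P - W \<subseteq> Q\<close> says that
  \<open>P\<close> lies in \<open>W \<union> Q\<close>, and the smallest remainder of such a
  \<open>P\<close> is taken. \<open>ARG_MIN\<close> fixes one choice among ties.\<close>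

definition fragment :: "'a set set \<Rightarrow> 'a set \<Rightarrow> 'a set \<Rightarrow> 'a set" where
  "fragment \<A> W Q = (ARG_MIN card T. \<exists>P\<in>\<A>. T = P - W \<and> T \<subseteq> Q)"

lemma fragment:
  assumes "Q \<in> \<A>"
  shows fragment_source: "\<exists>P\<in>\<A>. fragment \<A> W Q = P - W"
    and fragment_subset: "fragment \<A> W Q \<subseteq> Q"
    and fragment_minimal: "P \<in> \<A> \<Longrightarrow> P - W \<subseteq> Q \<Longrightarrow> card (fragment \<A> W Q) \<le> card (P - W)"
proof -
  let ?P = "\<lambda>T. \<exists>P\<in>\<A>. T = P - W \<and> T \<subseteq> Q"
  have "?P (Q - W)" using assms by blast
  then have "?P (fragment \<A> W Q)" unfolding fragment_def by (rule arg_min_natI)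
  then show "\<exists>P\<in>\<A>. fragment \<A> W Q = P - W" "fragment \<A> W Q \<subseteq> Q" by auto
  show "card (fragment \<A> W Q) \<le> card (P - W)" if "P \<in> \<A>" "P - W \<subseteq> Q"
    unfolding fragment_def by (rule arg_min_nat_le) (use that in blast)
qed

definition recolour :: "'c \<Rightarrow> 'a set \<Rightarrow> ('a \<Rightarrow> 'c) \<Rightarrow> 'a \<Rightarrow> 'c" where
  "recolour b T \<chi> = (\<lambda>x. if x \<in> T then b else \<chi> x)"

text \<open>Used for two rounds: \<open>I \<chi>\<close> holds the members still in play and
  \<open>A \<chi> S\<close> what is left of \<open>S\<close>. By \<open>invariant\<close> both stay
  the same when a fragment is repainted, so they can be read off the repainted colouring. The
  factors of the bound count the repainted colouring, then the fragment, then the old colours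
  together with the set.\<close>

lemma fragment_count:
  fixes A :: "('a \<Rightarrow> nat) \<Rightarrow> 'a set \<Rightarrow> 'a set" and I :: "('a \<Rightarrow> nat) \<Rightarrow> 'a set set" and r :: real and b :: nat
  defines "T \<equiv> \<lambda>\<chi> S. fragment (A \<chi> ` I \<chi>) (\<chi> -` {b}) (A \<chi> S)"
  assumes X: "finite X" and H: "H \<subseteq> Pow X" and b: "b < N" and r: "r \<ge> 0"
    and I: "\<And>\<chi>. I \<chi> \<subseteq> H"
    and A: "\<And>\<chi> S. S \<in> I \<chi> \<Longrightarrow> A \<chi> S \<subseteq> S" "\<And>\<chi> S. S \<in> I \<chi> \<Longrightarrow> card (A \<chi> S) \<le> m"
    and invariant: "\<And>\<chi> S U. S \<in> I \<chi> \<Longrightarrow> U \<subseteq> A \<chi> S \<Longrightarrow>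
        I (recolour b U \<chi>) = I \<chi> \<and> (\<forall>S'\<in>I \<chi>. A (recolour b U \<chi>) S' = A \<chi> S')"
    and spread: "\<And>Z. Z \<subseteq> X \<Longrightarrow> card {S \<in> H. Z \<subseteq> S} \<le> r ^ card Z * card H"
  shows "(\<Sum>\<chi>\<in>X \<rightarrow>\<^sub>E {..<N}. real (card {S \<in> I \<chi>. card (T \<chi> S) = t}))
    \<le> real N ^ card X * (m choose t) * (N * r) ^ t * card H"
proof -
  define \<Omega> where "\<Omega> = X \<rightarrow>\<^sub>E {..<N}"
  have finH: "finite H" using H X by (meson finite_Pow_iff finite_subset)
  have fin\<Omega>: "finite \<Omega>" unfolding \<Omega>_def by (intro finite_PiE X) auto
  have AX: "A \<chi> S \<subseteq> X" if "S \<in> I \<chi>" for \<chi> S using A(1)[OF that] I H that by blast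
  \<comment> \<open>\<open>P \<chi>\<close> depends on the colouring alone: it is one remainder
    lying wholly in colour \<open>b\<close>. The default \<open>{}\<close> keeps the size bound
    \<open>m\<close> when there is none.\<close>
  define P where "P \<chi> = (if \<exists>S\<in>I \<chi>. A \<chi> S \<subseteq> \<chi> -` {b} then A \<chi> (SOME S. S \<in> I \<chi> \<and> A \<chi> S \<subseteq> \<chi> -` {b}) else {})" for \<chi>
  have P: "P \<chi> \<subseteq> \<chi> -` {b}" "\<exists>S\<in>I \<chi>. P \<chi> = A \<chi> S" if "\<exists>S\<in>I \<chi>. A \<chi> S \<subseteq> \<chi> -` {b}" for \<chi>
  proof -
    have "(SOME S. S \<in> I \<chi> \<and> A \<chi> S \<subseteq> \<chi> -` {b}) \<in> I \<chi> \<and>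
        A \<chi> (SOME S. S \<in> I \<chi> \<and> A \<chi> S \<subseteq> \<chi> -` {b}) \<subseteq> \<chi> -` {b}"
      by (rule someI_ex) (use that in blast)
    then show "P \<chi> \<subseteq> \<chi> -` {b}" "\<exists>S\<in>I \<chi>. P \<chi> = A \<chi> S" unfolding P_def using that by auto
  qed
  have Pm: "P \<chi> \<subseteq> X" "card (P \<chi>) \<le> m" for \<chi>
  proof -
    have "P \<chi> \<subseteq> X \<and> card (P \<chi>) \<le> m"
    proof (cases "\<exists>S\<in>I \<chi>. A \<chi> S \<subseteq> \<chi> -` {b}")
      case True
      then show ?thesis using P(2)[OF True] AX A(2) by force
    next
      case False
      then show ?thesis unfolding P_def by simp
    qed
    then show "P \<chi> \<subseteq> X" "card (P \<chi>) \<le> m" by auto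
  qed
  text \<open>
    A pair is encoded by the recoloured colouring, the fragment, the old colours on the fragment,
    and the set; the fragment is cheap to name, being a subset of \<open>P\<close> of the recoloured colouring.
  \<close>
  have key: "recolour b (T \<chi> S) \<chi> \<in> \<Omega> \<and> T \<chi> S \<subseteq> P (recolour b (T \<chi> S) \<chi>) \<and> T \<chi> S \<subseteq> S"
    if \<chi>: "\<chi> \<in> \<Omega>" and S: "S \<in> I \<chi>" for \<chi> S
  proof -
    define \<chi>' where "\<chi>' = recolour b (T \<chi> S) \<chi>"
    have AS: "A \<chi> S \<in> A \<chi> ` I \<chi>" using S by blast
    have TA: "T \<chi> S \<subseteq> A \<chi> S" unfolding T_def by (rule fragment_subset[OF AS])
    then have TX: "T \<chi> S \<subseteq> X" using AX[OF S] by blast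
    have inv: "I \<chi>' = I \<chi>" "\<And>S'. S' \<in> I \<chi> \<Longrightarrow> A \<chi>' S' = A \<chi> S'"
      using invariant[OF S TA] unfolding \<chi>'_def by auto
    have W: "\<chi>' -` {b} = \<chi> -` {b} \<union> T \<chi> S" unfolding \<chi>'_def recolour_def by auto
    obtain S' where S': "S' \<in> I \<chi>" "T \<chi> S = A \<chi> S' - \<chi> -` {b}"
      using fragment_source[OF AS, of "\<chi> -` {b}"] unfolding T_def by blast
    \<comment> \<open>After repainting, the remainder of the set \<open>S'\<close> that yields the
      fragment is wholly of colour \<open>b\<close>, so \<open>P \<chi>'\<close> is not the
      default.\<close>
    have ex: "\<exists>S\<in>I \<chi>'. A \<chi>' S \<subseteq> \<chi>' -` {b}"
      using S' unfolding W inv(1) using inv(2) by (intro bexI[of _ S']) auto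
    obtain S'' where S'': "S'' \<in> I \<chi>" "P \<chi>' = A \<chi> S''"
      using P(2)[OF ex] inv by auto
    have sub: "A \<chi> S'' - \<chi> -` {b} \<subseteq> T \<chi> S" using P(1)[OF ex] unfolding S'' W by blast
    \<comment> \<open>The part of \<open>P \<chi>'\<close> outside the old colour \<open>b\<close>
      lies inside the fragment and competes in its definition. Minimality forces equality, so the
      fragment is a subset of \<open>P \<chi>'\<close>.\<close>
    have "card (T \<chi> S) \<le> card (A \<chi> S'' - \<chi> -` {b})"
      unfolding T_def
    proof (rule fragment_minimal[OF AS])
      show "A \<chi> S'' - \<chi> -` {b} \<subseteq> A \<chi> S" using sub TA by blast
    qed (use S'' in blast)
    then have "A \<chi> S'' - \<chi> -` {b} = T \<chi> S"
      using sub TX X by (meson card_seteq finite_subset)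
    then have "T \<chi> S \<subseteq> P \<chi>'" unfolding S'' by blast
    moreover have "\<chi>' \<in> \<Omega>" using \<chi> TX b unfolding \<Omega>_def \<chi>'_def recolour_def by (auto simp: PiE_iff extensional_def)
    ultimately show ?thesis using TA A(1)[OF S] unfolding \<chi>'_def by blast
  qed
  define D where "D = Sigma \<Omega> (\<lambda>\<chi>. {S \<in> I \<chi>. card (T \<chi> S) = t})"
  define E where "E = Sigma \<Omega> (\<lambda>\<chi>'. Sigma {U. U \<subseteq> P \<chi>' \<and> card U = t} (\<lambda>U. (U \<rightarrow>\<^sub>E {..<N}) \<times> {S \<in> H. U \<subseteq> S}))"
  define code where "code = (\<lambda>(\<chi>, S). (recolour b (T \<chi> S) \<chi>, T \<chi> S, restrict \<chi> (T \<chi> S), S))"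
  have finE: "finite {U. U \<subseteq> P \<chi> \<and> card U = t}" for \<chi>
    using finite_subset[OF Pm(1)[of \<chi>] X] by simp
  have finU: "finite U" if "U \<in> {U. U \<subseteq> P \<chi> \<and> card U = t}" for U \<chi>
    using that finite_subset[OF _ finite_subset[OF Pm(1)[of \<chi>] X]] by simp
  have finE': "finite ((U \<rightarrow>\<^sub>E {..<N}) \<times> {S \<in> H. U \<subseteq> S})" if "U \<in> {U. U \<subseteq> P \<chi> \<and> card U = t}" for U \<chi>
    using finU[OF that] finH by (intro finite_cartesian_product finite_PiE) auto
  have "inj_on code D"
  proof (rule inj_onI, clarify)
    fix \<chi> S \<chi>' S'
    assume eq: "code (\<chi>, S) = code (\<chi>', S')"
    then have S: "S = S'" and Teq: "T \<chi> S = T \<chi>' S'"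
      and res: "restrict \<chi> (T \<chi> S) = restrict \<chi>' (T \<chi> S)"
      and rec: "recolour b (T \<chi> S) \<chi> = recolour b (T \<chi> S) \<chi>'"
      unfolding code_def by auto
    have "\<chi> x = \<chi>' x" for x
      using fun_cong[OF res, of x] fun_cong[OF rec, of x] unfolding recolour_def by (auto split: if_splits)
    then show "\<chi> = \<chi>' \<and> S = S'" using S by blast
  qed
  moreover have "code ` D \<subseteq> E"
  proof
    fix y assume "y \<in> code ` D"
    then obtain \<chi> S where d: "\<chi> \<in> \<Omega>" "S \<in> I \<chi>" "card (T \<chi> S) = t"
      and y: "y = (recolour b (T \<chi> S) \<chi>, T \<chi> S, restrict \<chi> (T \<chi> S), S)"
      unfolding D_def code_def by auto
    have k: "recolour b (T \<chi> S) \<chi> \<in> \<Omega>" "T \<chi> S \<subseteq> P (recolour b (T \<chi> S) \<chi>)" "T \<chi> S \<subseteq> S"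
      using key[OF d(1,2)] by auto
    have "S \<in> H" using I d(2) by blast
    moreover from this have "restrict \<chi> (T \<chi> S) \<in> T \<chi> S \<rightarrow>\<^sub>E {..<N}"
      using d(1) k(3) H unfolding \<Omega>_def by (auto simp: PiE_iff)
    ultimately show "y \<in> E" unfolding E_def y using k d(3) by simp
  qed
  moreover have "finite E" unfolding E_def by (intro finite_SigmaI[OF fin\<Omega>] finite_SigmaI[OF finE] finE')
  ultimately have DE: "card D \<le> card E" by (rule card_inj_on_le)
  have cardE_inner: "real (card (Sigma {U. U \<subseteq> P \<chi> \<and> card U = t} (\<lambda>U. (U \<rightarrow>\<^sub>E {..<N}) \<times> {S \<in> H. U \<subseteq> S})))
      \<le> (m choose t) * ((N * r) ^ t * card H)" for \<chi>
  proof -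
    have "real (card (Sigma {U. U \<subseteq> P \<chi> \<and> card U = t} (\<lambda>U. (U \<rightarrow>\<^sub>E {..<N}) \<times> {S \<in> H. U \<subseteq> S})))
      = (\<Sum>U | U \<subseteq> P \<chi> \<and> card U = t. real (card ((U \<rightarrow>\<^sub>E {..<N}) \<times> {S \<in> H. U \<subseteq> S})))"
      using finE finE' by (subst card_SigmaI) auto
    also have "\<dots> \<le> (\<Sum>U | U \<subseteq> P \<chi> \<and> card U = t. (N * r) ^ t * card H)"
    proof (rule sum_mono)
      fix U assume U: "U \<in> {U. U \<subseteq> P \<chi> \<and> card U = t}"
      have "real (card ((U \<rightarrow>\<^sub>E {..<N}) \<times> {S \<in> H. U \<subseteq> S})) = real N ^ t * card {S \<in> H. U \<subseteq> S}"
        using U finU[OF U] by (simp add: card_cartesian_product card_funcsetE)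
      also have "\<dots> \<le> real N ^ t * (r ^ t * card H)"
        using spread[of U] U Pm(1)[of \<chi>] by (intro mult_left_mono) auto
      finally show "real (card ((U \<rightarrow>\<^sub>E {..<N}) \<times> {S \<in> H. U \<subseteq> S})) \<le> (N * r) ^ t * card H"
        by (simp add: power_mult_distrib mult.assoc)
    qed
    also have "\<dots> = (card (P \<chi>) choose t) * ((N * r) ^ t * card H)"
      using n_subsets[OF finite_subset[OF Pm(1)[of \<chi>] X], of t] by simp
    also have "\<dots> \<le> (m choose t) * ((N * r) ^ t * card H)"
      using binomial_right_mono[OF Pm(2)[of \<chi>], of t] r by (intro mult_right_mono) auto
    finally show ?thesis .
  qed
  have "(\<Sum>\<chi>\<in>\<Omega>. real (card {S \<in> I \<chi>. card (T \<chi> S) = t})) = card D"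
    unfolding D_def using fin\<Omega> finite_subset[OF I finH] by (subst card_SigmaI) auto
  also have "\<dots> \<le> real (card E)" using DE by simp
  also have "\<dots> = (\<Sum>\<chi>\<in>\<Omega>. real (card (Sigma {U. U \<subseteq> P \<chi> \<and> card U = t} (\<lambda>U. (U \<rightarrow>\<^sub>E {..<N}) \<times> {S \<in> H. U \<subseteq> S}))))"
    unfolding E_def using fin\<Omega> finE finE' by (subst card_SigmaI) auto
  also have "\<dots> \<le> (\<Sum>\<chi>\<in>\<Omega>. (m choose t) * ((N * r) ^ t * card H))"
    using cardE_inner by (rule sum_mono)
  also have "\<dots> = real N ^ card X * (m choose t) * (N * r) ^ t * card H"
    unfolding \<Omega>_def using X by (simp add: card_funcsetE)
  finally show ?thesis unfolding \<Omega>_def .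
qed

section \<open>Averaging over random colourings\<close>

lemma sum_card_by_value_le:
  fixes g :: "nat \<Rightarrow> real"
  assumes "finite K"
    and "\<And>t. t \<in> K \<Longrightarrow> (\<Sum>\<chi>\<in>\<Omega>. real (card {S \<in> I \<chi>. f \<chi> S = t})) \<le> g t"
  shows "(\<Sum>\<chi>\<in>\<Omega>. real (card {S \<in> I \<chi>. f \<chi> S \<in> K})) \<le> sum g K"
proof -
  have "(\<Sum>\<chi>\<in>\<Omega>. real (card {S \<in> I \<chi>. f \<chi> S \<in> K})) \<le> (\<Sum>\<chi>\<in>\<Omega>. \<Sum>t\<in>K. real (card {S \<in> I \<chi>. f \<chi> S = t}))"
  proof (rule sum_mono)
    fix \<chi>
    have "{S \<in> I \<chi>. f \<chi> S \<in> K} = (\<Union>t\<in>K. {S \<in> I \<chi>. f \<chi> S = t})" by blast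
    then have "card {S \<in> I \<chi>. f \<chi> S \<in> K} \<le> (\<Sum>t\<in>K. card {S \<in> I \<chi>. f \<chi> S = t})"
      using card_UN_le[OF assms(1), of "\<lambda>t. {S \<in> I \<chi>. f \<chi> S = t}"] by simp
    then show "real (card {S \<in> I \<chi>. f \<chi> S \<in> K}) \<le> (\<Sum>t\<in>K. real (card {S \<in> I \<chi>. f \<chi> S = t}))"
      unfolding of_nat_sum[symmetric] of_nat_le_iff .
  qed
  also have "\<dots> = (\<Sum>t\<in>K. \<Sum>\<chi>\<in>\<Omega>. real (card {S \<in> I \<chi>. f \<chi> S = t}))" by (rule sum.swap)
  also have "\<dots> \<le> sum g K" using assms(2) by (rule sum_mono)
  finally show ?thesis .
qed

text \<open>Markov's inequality in counting form.\<close>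

lemma card_times_le_sum:
  fixes f :: "'a \<Rightarrow> real" and c :: real
  assumes "finite \<Omega>" "B \<subseteq> \<Omega>" "\<And>\<chi>. \<chi> \<in> B \<Longrightarrow> c \<le> f \<chi>" "\<And>\<chi>. \<chi> \<in> \<Omega> \<Longrightarrow> 0 \<le> f \<chi>"
  shows "card B * c \<le> sum f \<Omega>"
proof -
  have "card B * c \<le> sum f B" using assms(3) by (rule sum_bounded_below)
  also have "\<dots> \<le> sum f \<Omega>" using assms by (intro sum_mono2) auto
  finally show ?thesis .
qed

lemma sum_binomial_tail_le:
  fixes y :: real
  assumes "0 \<le> y" "y \<le> 1"
  shows "(\<Sum>t\<in>{m<..s}. (s choose t) * y ^ t) \<le> 2 ^ s * y ^ (m + 1)"
proof -
  have "(\<Sum>t\<in>{m<..s}. (s choose t) * y ^ t) \<le> (\<Sum>t\<in>{m<..s}. (s choose t) * y ^ (m + 1))"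
    using assms by (intro sum_mono mult_left_mono power_decreasing) auto
  also have "\<dots> \<le> (\<Sum>t\<le>s. (s choose t) * y ^ (m + 1))"
    using assms by (intro sum_mono2) auto
  also have "\<dots> = real (\<Sum>t\<le>s. s choose t) * y ^ (m + 1)"
    by (simp add: sum_distrib_right)
  finally show ?thesis by (simp add: choose_row_sum)
qed

lemma sum_binomial_positive:
  fixes y :: real
  shows "(\<Sum>t\<in>{0<..m}. (m choose t) * y ^ t) = (1 + y) ^ m - 1"
proof -
  have "(1 + y) ^ m = (\<Sum>t\<le>m. (m choose t) * y ^ t)"
    using binomial_ring[of y 1 m] by (simp add: add.commute)
  also have "{..m} = insert 0 {0<..m}" by auto
  finally show ?thesis by simp
qed

text \<open>Two rounds, each losing at most a quarter of the colourings. Colour \<open>a\<close> has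
  to leave fragments of size at most \<open>m\<close>, and colour \<open>b\<close> has to swallow
  one of these. In each round at most \<open>1/8\<close> of the members misbehave on average, and
  Markov's inequality at level one half turns this into the quarter.\<close>

lemma two_colour_failures:
  fixes r :: real
  assumes X: "finite X" and H: "H \<subseteq> Pow X" "H \<noteq> {}" and s: "\<And>S. S \<in> H \<Longrightarrow> card S \<le> s"
    and ab: "a < N" "b < N" "a \<noteq> b" and r: "r \<ge> 0"
    and spread: "\<And>Z. Z \<subseteq> X \<Longrightarrow> card {S \<in> H. Z \<subseteq> S} \<le> r ^ card Z * card H"
    and y: "N * r \<le> 1" "8 * (2 ^ s * (N * r) ^ (m + 1)) \<le> 1" "8 * ((1 + N * r) ^ m - 1) \<le> 1"
  shows "card {\<chi> \<in> X \<rightarrow>\<^sub>E {..<N}. \<not> (\<exists>S\<in>H. S \<subseteq> \<chi> -` {a, b})} \<le> real N ^ card X / 2"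
proof -
  define \<Omega> where "\<Omega> = X \<rightarrow>\<^sub>E {..<N}"
  define M where "M = real N ^ card X"
  define h where "h = real (card H)"
  have finH: "finite H" using H X by (meson finite_Pow_iff finite_subset)
  have h: "h > 0" using finH H(2) unfolding h_def by (simp add: card_gt_0_iff)
  have M: "M \<ge> 0" unfolding M_def by simp
  have y0: "0 \<le> N * r" using r by simp
  have fin\<Omega>: "finite \<Omega>" unfolding \<Omega>_def by (intro finite_PiE X) auto
  define Q where "Q \<chi> = fragment H (\<chi> -` {a})" for \<chi> :: "'a \<Rightarrow> nat"
  define big where "big \<chi> = {S \<in> H. card (Q \<chi> S) \<in> {m<..s}}" for \<chi>
  have QS: "Q \<chi> S \<subseteq> S" if "S \<in> H" for \<chi> S
    unfolding Q_def using fragment_subset[OF that] .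
  have Qs: "card (Q \<chi> S) \<le> s" if "S \<in> H" for \<chi> S
  proof -
    have "finite S" using that H(1) X finite_subset by blast
    then show ?thesis using card_mono[OF _ QS[OF that]] s[OF that] by (meson le_trans)
  qed
  have count1: "(\<Sum>\<chi>\<in>\<Omega>. real (card {S \<in> H. card (Q \<chi> S) = t})) \<le> M * h * ((s choose t) * (N * r) ^ t)" for t
    using fragment_count[OF X H(1) ab(1) r, of "\<lambda>_. H" "\<lambda>_ S. S" s t] s spread
    unfolding \<Omega>_def M_def h_def Q_def by (simp add: mult_ac)
  have "(\<Sum>\<chi>\<in>\<Omega>. real (card (big \<chi>))) \<le> (\<Sum>t\<in>{m<..s}. M * h * ((s choose t) * (N * r) ^ t))"
    unfolding big_def by (rule sum_card_by_value_le[OF _ count1]) simp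
  also have "\<dots> = M * h * (\<Sum>t\<in>{m<..s}. (s choose t) * (N * r) ^ t)" by (simp add: sum_distrib_left)
  also have "\<dots> \<le> M * h * (1 / 8)"
    using sum_binomial_tail_le[OF y0 y(1), of s m] y(2) M h by (intro mult_left_mono) auto
  finally have sum1: "(\<Sum>\<chi>\<in>\<Omega>. real (card (big \<chi>))) \<le> M * h * (1 / 8)" .
  define bad where "bad = {\<chi> \<in> \<Omega>. h / 2 < card (big \<chi>)}"
  have "card bad * (h / 2) \<le> (\<Sum>\<chi>\<in>\<Omega>. real (card (big \<chi>)))"
    unfolding bad_def using fin\<Omega> by (intro card_times_le_sum) auto
  then have "h * (card bad / 2) \<le> h * (M / 8)" using sum1 by (simp add: mult_ac)
  then have bad: "card bad \<le> M / 4" using h by simp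

  \<comment> \<open>A bad colouring is left without members; under any other at least half of
    \<open>H\<close> stays in play.\<close>
  define I where "I \<chi> = (if h / 2 < card (big \<chi>) then {} else H - big \<chi>)" for \<chi>
  define T where "T \<chi> S = fragment (Q \<chi> ` I \<chi>) (\<chi> -` {b}) (Q \<chi> S)" for \<chi> S
  have IH: "I \<chi> \<subseteq> H" for \<chi> unfolding I_def by auto
  have Qm: "card (Q \<chi> S) \<le> m" if "S \<in> I \<chi>" for \<chi> S
    using that Qs[of S \<chi>] unfolding I_def big_def by (auto split: if_splits)
  have count2: "(\<Sum>\<chi>\<in>\<Omega>. real (card {S \<in> I \<chi>. card (T \<chi> S) = t})) \<le> M * h * ((m choose t) * (N * r) ^ t)" for t
  proof -
    have "(\<Sum>\<chi>\<in>\<Omega>. real (card {S \<in> I \<chi>. card (T \<chi> S) = t})) \<le> real N ^ card X * (m choose t) * (N * r) ^ t * card H"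
      unfolding \<Omega>_def T_def
    proof (rule fragment_count[OF X H(1) ab(2) r IH])
      show "Q \<chi> S \<subseteq> S" if "S \<in> I \<chi>" for \<chi> S using QS IH that by blast
      show "card (Q \<chi> S) \<le> m" if "S \<in> I \<chi>" for \<chi> S using Qm[OF that] .
      show "I (recolour b U \<chi>) = I \<chi> \<and> (\<forall>S'\<in>I \<chi>. Q (recolour b U \<chi>) S' = Q \<chi> S')"
        if S: "S \<in> I \<chi>" and U: "U \<subseteq> Q \<chi> S" for \<chi> S U
      proof -
        have "S \<in> H" using S IH by blast
        then obtain S' where "Q \<chi> S = S' - \<chi> -` {a}"
          using fragment_source[of S H "\<chi> -` {a}"] unfolding Q_def by blast
        \<comment> \<open>\<open>U\<close> avoids colour \<open>a\<close> and is painted with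
          \<open>b \<noteq> a\<close>, so the outcome of the first round is untouched.\<close>
        then have "recolour b U \<chi> -` {a} = \<chi> -` {a}"
          using U ab(3) unfolding recolour_def by auto
        then have "Q (recolour b U \<chi>) = Q \<chi>" unfolding Q_def by simp
        then show ?thesis unfolding I_def big_def by simp
      qed
    qed (use spread in blast)
    then show ?thesis unfolding M_def h_def by (simp add: mult_ac)
  qed
  define fail where "fail = {\<chi> \<in> \<Omega> - bad. \<not> (\<exists>S\<in>H. S \<subseteq> \<chi> -` {a, b})}"
  have large: "h / 2 \<le> card {S \<in> I \<chi>. card (T \<chi> S) \<in> {0<..m}}" if "\<chi> \<in> fail" for \<chi>
  proof -
    have nb: "card (big \<chi>) \<le> h / 2" and no: "\<not> (\<exists>S\<in>H. S \<subseteq> \<chi> -` {a, b})"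
      using that unfolding fail_def bad_def by auto
    have "card (T \<chi> S) \<in> {0<..m}" if S: "S \<in> I \<chi>" for S
    proof -
      have QI: "Q \<chi> S \<in> Q \<chi> ` I \<chi>" using S by blast
      have SH: "S \<in> H" using S IH by blast
      have TQ: "T \<chi> S \<subseteq> Q \<chi> S" unfolding T_def by (rule fragment_subset[OF QI])
      have finQ: "finite (Q \<chi> S)" using QS[OF SH, of \<chi>] SH H(1) X by (meson PowD finite_subset subsetD)
      \<comment> \<open>An empty second fragment would expose a member of \<open>H\<close> with all
        points of colour \<open>a\<close> or \<open>b\<close>.\<close>
      have "T \<chi> S \<noteq> {}"
      proof
        assume empty: "T \<chi> S = {}"
        obtain S' where S': "S' \<in> I \<chi>" "T \<chi> S = Q \<chi> S' - \<chi> -` {b}"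
          using fragment_source[OF QI, of "\<chi> -` {b}"] unfolding T_def by blast
        have "S' \<in> H" using S'(1) IH by blast
        then obtain S'' where "S'' \<in> H" "Q \<chi> S' = S'' - \<chi> -` {a}"
          using fragment_source[of S' H "\<chi> -` {a}"] unfolding Q_def by blast
        then have "S'' \<subseteq> \<chi> -` {a, b}" using S'(2) empty by auto
        then show False using no \<open>S'' \<in> H\<close> by blast
      qed
      then show ?thesis
        using TQ finQ card_mono[OF finQ TQ] Qm[OF S] by (auto simp: card_gt_0_iff finite_subset)
    qed
    then have "{S \<in> I \<chi>. card (T \<chi> S) \<in> {0<..m}} = H - big \<chi>"
      using nb unfolding I_def by auto
    moreover have "card (H - big \<chi>) = card H - card (big \<chi>)"
      unfolding big_def using finH by (intro card_Diff_subset) auto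
    ultimately show ?thesis using nb unfolding h_def by simp
  qed
  have "card fail * (h / 2) \<le> (\<Sum>\<chi>\<in>\<Omega>. real (card {S \<in> I \<chi>. card (T \<chi> S) \<in> {0<..m}}))"
    by (rule card_times_le_sum[OF fin\<Omega> _ large]) (auto simp: fail_def)
  also have "\<dots> \<le> (\<Sum>t\<in>{0<..m}. M * h * ((m choose t) * (N * r) ^ t))"
    by (rule sum_card_by_value_le[OF _ count2]) simp
  also have "\<dots> = M * h * ((1 + N * r) ^ m - 1)"
    unfolding sum_binomial_positive[symmetric] by (simp add: sum_distrib_left)
  also have "\<dots> \<le> M * h * (1 / 8)" using y(3) M h by (intro mult_left_mono) auto
  finally have "h * (card fail / 2) \<le> h * (M / 8)" by (simp add: mult_ac)
  then have fail: "card fail \<le> M / 4" using h by simp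

  have "{\<chi> \<in> \<Omega>. \<not> (\<exists>S\<in>H. S \<subseteq> \<chi> -` {a, b})} \<subseteq> bad \<union> fail" unfolding fail_def by blast
  moreover have "finite (bad \<union> fail)" using fin\<Omega> unfolding bad_def fail_def by auto
  ultimately have "card {\<chi> \<in> \<Omega>. \<not> (\<exists>S\<in>H. S \<subseteq> \<chi> -` {a, b})} \<le> card bad + card fail"
    by (meson card_Un_le card_mono le_trans)
  then show ?thesis using bad fail unfolding \<Omega>_def M_def by linarith
qed

text \<open>The \<open>4 * k\<close> colours form \<open>2 * k\<close> disjoint pairs, each failing
  for at most half of the colourings. The average number of failing pairs is thus at most
  \<open>k\<close>, so some colouring has \<open>k\<close> successful pairs, and members in
  different pairs are disjoint.\<close>

lemma spread_imp_k_sunflower: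
  fixes r :: real and N k :: nat
  assumes X: "finite X" and H: "H \<subseteq> Pow X" "H \<noteq> {}" "{} \<notin> H" and s: "\<And>S. S \<in> H \<Longrightarrow> card S \<le> s"
    and r: "r \<ge> 0" and N: "N = 4 * k" "k \<ge> 1"
    and spread: "\<And>Z. Z \<subseteq> X \<Longrightarrow> card {S \<in> H. Z \<subseteq> S} \<le> r ^ card Z * card H"
    and y: "N * r \<le> 1" "8 * (2 ^ s * (N * r) ^ (m + 1)) \<le> 1" "8 * ((1 + N * r) ^ m - 1) \<le> 1"
  shows "\<exists>B\<subseteq>H. k_sunflower k B"
proof -
  define \<Omega> where "\<Omega> = X \<rightarrow>\<^sub>E {..<N}"
  have fin\<Omega>: "finite \<Omega>" unfolding \<Omega>_def by (intro finite_PiE X) auto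
  have card\<Omega>: "card \<Omega> = N ^ card X" unfolding \<Omega>_def using X by (simp add: card_funcsetE)
  define win where "win \<chi> i \<longleftrightarrow> (\<exists>S\<in>H. S \<subseteq> \<chi> -` {2 * i, 2 * i + 1})" for \<chi> :: "'a \<Rightarrow> nat" and i
  have lose: "card {\<chi> \<in> \<Omega>. \<not> win \<chi> i} \<le> real N ^ card X / 2" if "i < 2 * k" for i
    unfolding \<Omega>_def win_def
    by (rule two_colour_failures[OF X H(1,2) s _ _ _ r spread y]) (use that N in auto)
  have "\<exists>\<chi>\<in>\<Omega>. k \<le> card {i \<in> {..<2 * k}. win \<chi> i}"
  proof (rule ccontr)
    assume neg: "\<not> ?thesis"
    have "k + 1 \<le> card {i \<in> {..<2 * k}. \<not> win \<chi> i}" if "\<chi> \<in> \<Omega>" for \<chi>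
    proof -
      have eq: "{i \<in> {..<2 * k}. \<not> win \<chi> i} = {..<2 * k} - {i \<in> {..<2 * k}. win \<chi> i}" by blast
      have "card {i \<in> {..<2 * k}. \<not> win \<chi> i} = 2 * k - card {i \<in> {..<2 * k}. win \<chi> i}"
        unfolding eq by (subst card_Diff_subset) auto
      moreover have "card {i \<in> {..<2 * k}. win \<chi> i} < k" using neg that by force
      ultimately show ?thesis by linarith
    qed
    then have "card \<Omega> * (k + 1) \<le> (\<Sum>\<chi>\<in>\<Omega>. card {i \<in> {..<2 * k}. \<not> win \<chi> i})"
      using sum_bounded_below[of \<Omega> "k + 1" "\<lambda>\<chi>. card {i \<in> {..<2 * k}. \<not> win \<chi> i}"] by simp
    also have "\<dots> = (\<Sum>i<2 * k. card {\<chi> \<in> \<Omega>. \<not> win \<chi> i})"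
      using sum_multicount_gen[OF _ fin\<Omega>, of "{..<2 * k}" "\<lambda>i \<chi>. \<not> win \<chi> i"
          "\<lambda>\<chi>. card {i \<in> {..<2 * k}. \<not> win \<chi> i}"] by simp
    finally have "real (card \<Omega> * (k + 1)) \<le> (\<Sum>i<2 * k. real (card {\<chi> \<in> \<Omega>. \<not> win \<chi> i}))"
      unfolding of_nat_sum[symmetric] of_nat_le_iff .
    also have "\<dots> \<le> (\<Sum>i<2 * k. real N ^ card X / 2)" using lose by (intro sum_mono) simp
    also have "\<dots> = real (card \<Omega> * k)" unfolding card\<Omega> by simp
    finally have "card \<Omega> * (k + 1) \<le> card \<Omega> * k" unfolding of_nat_le_iff .
    moreover have "card \<Omega> > 0" unfolding card\<Omega> using N by simp
    ultimately show False by simp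
  qed
  then obtain \<chi> where "k \<le> card {i \<in> {..<2 * k}. win \<chi> i}" by blast
  then obtain J where J: "J \<subseteq> {i \<in> {..<2 * k}. win \<chi> i}" "card J = k" "finite J"
    by (rule obtain_subset_with_card_n)
  then have "\<forall>i\<in>J. \<exists>S\<in>H. S \<subseteq> \<chi> -` {2 * i, 2 * i + 1}" unfolding win_def by blast
  then obtain S where S: "\<And>i. i \<in> J \<Longrightarrow> S i \<in> H" "\<And>i. i \<in> J \<Longrightarrow> S i \<subseteq> \<chi> -` {2 * i, 2 * i + 1}"
    by metis
  have dis: "S i \<inter> S j = {}" if "i \<in> J" "j \<in> J" "i \<noteq> j" for i j
  proof -
    have "{2 * i, 2 * i + 1} \<inter> {2 * j, 2 * j + 1} = {}" using that(3) by auto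
    then show ?thesis using S(2)[OF that(1)] S(2)[OF that(2)] by blast
  qed
  \<comment> \<open>Disjoint sets can coincide only if they are empty, which
    \<open>{} \<notin> H\<close> forbids; so there are \<open>k\<close> distinct sets.\<close>
  have "inj_on S J"
  proof (rule inj_onI, rule ccontr)
    fix i j assume ij: "i \<in> J" "j \<in> J" "S i = S j" "i \<noteq> j"
    then have "S i = {}" using dis[OF ij(1,2,4)] by simp
    then show False using S(1)[OF ij(1)] H(3) by simp
  qed
  then have "card (S ` J) = k" using J(2) by (simp add: card_image)
  moreover have "disjoint (S ` J)"
    using dis by (auto simp: disjoint_def)
  ultimately have "k_sunflower k (S ` J)" using J(3) by (intro k_sunflower_disjoint) auto
  moreover have "S ` J \<subseteq> H" using S(1) by blast
  ultimately show ?thesis by blast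
qed

section \<open>Spread links\<close>

text \<open>\<open>Z\<close> maximises the weight \<open>d Z\<close>, the number of members
  containing \<open>Z\<close> times \<open>R ^ card Z\<close>. Comparison with
  \<open>Z \<union> Y\<close> gives the spread inequality. Comparison with \<open>{}\<close> gives
  \<open>R ^ s < d Z\<close>, which rules out \<open>card Z \<ge> s\<close>, since at most one
  member contains such a \<open>Z\<close>.\<close>

lemma ex_spread_link:
  fixes R :: real
  assumes uni: "uniform_family s F" and R: "R > 0" and big: "R ^ s < card F"
  obtains Z where "Z \<subseteq> \<Union>F" "card Z < s" "link Z F \<noteq> {}"
    "\<And>Y. card {S \<in> link Z F. Y \<subseteq> S} \<le> (1 / R) ^ card Y * card (link Z F)"
proof -
  note F = uniform_familyD[OF uni]
  have finX: "finite (\<Union>F)" using F(1,2) by blast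
  define d where "d Z = real (card {U \<in> F. Z \<subseteq> U}) * R ^ card Z" for Z
  have "Max (d ` Pow (\<Union>F)) \<in> d ` Pow (\<Union>F)" using finX by (intro Max_in) auto
  then obtain Z where Z: "Z \<subseteq> \<Union>F" and maxZ: "d Z = Max (d ` Pow (\<Union>F))" by auto
  have max: "d Y \<le> d Z" if "Y \<subseteq> \<Union>F" for Y unfolding maxZ using finX that by (intro Max_ge) auto
  have finZ: "finite Z" using Z finX finite_subset by blast
  have dZ: "R ^ s < d Z" using max[of "{}"] big unfolding d_def by simp
  show thesis
  proof
    show "Z \<subseteq> \<Union>F" by (rule Z)
    have "d Z > 0" using dZ R by (smt (verit) zero_less_power)
    then have "card {U \<in> F. Z \<subseteq> U} \<noteq> 0" unfolding d_def by (intro notI) simp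
    then have "{U \<in> F. Z \<subseteq> U} \<noteq> {}" by force
    then show "link Z F \<noteq> {}" unfolding link_def by simp
    show "card Z < s"
    proof (rule ccontr)
      assume "\<not> card Z < s"
      have eq: "U = Z" if "U \<in> F" "Z \<subseteq> U" for U
        using card_seteq[OF F(2)[OF that(1)] that(2)] F(3)[OF that(1)] \<open>\<not> card Z < s\<close> by simp
      have "card {U \<in> F. Z \<subseteq> U} \<le> 1"
        using card_mono[of "{Z}" "{U \<in> F. Z \<subseteq> U}"] eq by auto
      moreover obtain U where "U \<in> F" "Z \<subseteq> U" using \<open>{U \<in> F. Z \<subseteq> U} \<noteq> {}\<close> by blast
      then have "card Z = s" using eq F(3) by blast
      ultimately have "d Z \<le> 1 * R ^ s" unfolding d_def using R by (intro mult_mono) auto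
      then show False using dZ by simp
    qed
    fix Y
    show "card {S \<in> link Z F. Y \<subseteq> S} \<le> (1 / R) ^ card Y * card (link Z F)"
    \<comment> \<open>\<open>Y\<close> is arbitrary here. If some set of the link contains it, then
      it is finite, disjoint from \<open>Z\<close> and inside the union of \<open>F\<close>, so
      \<open>Z \<union> Y\<close> takes part in the maximum.\<close>
    proof (cases "{S \<in> link Z F. Y \<subseteq> S} = {}")
      case True
      show ?thesis unfolding True using R by simp
    next
      case False
      then obtain U where U: "U \<in> F" "Z \<subseteq> U" "Y \<subseteq> U - Z" unfolding link_def by blast
      then have YZ: "Z \<inter> Y = {}" "Z \<union> Y \<subseteq> \<Union>F" "finite Y" using finite_subset F(2) by blast+
      have "{S \<in> link Z F. Y \<subseteq> S} \<subseteq> (\<lambda>U. U - Z) ` {U \<in> F. Z \<union> Y \<subseteq> U}" unfolding link_def by blast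
      then have "card {S \<in> link Z F. Y \<subseteq> S} \<le> card {U \<in> F. Z \<union> Y \<subseteq> U}"
        using F(1) by (intro surj_card_le) auto
      moreover have "card {U \<in> F. Z \<union> Y \<subseteq> U} * R ^ card Y \<le> card {U \<in> F. Z \<subseteq> U}"
      proof -
        have "(card {U \<in> F. Z \<union> Y \<subseteq> U} * R ^ card Y) * R ^ card Z \<le> card {U \<in> F. Z \<subseteq> U} * R ^ card Z"
          using max[OF YZ(2)] unfolding d_def card_Un_disjoint[OF finZ YZ(3,1)]
          by (simp add: power_add mult_ac)
        then show ?thesis using R by (simp add: mult_le_cancel_right)
      qed
      ultimately show ?thesis unfolding card_link using R
        by (simp add: power_divide pos_le_divide_eq) (smt (verit) mult_right_mono of_nat_mono zero_le_power)
    qed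
  qed
qed

text \<open>\<open>q\<close> plays the role of \<open>1 / (N * r)\<close>. The 8 in \<open>m\<close>
  and \<open>ln q \<ge> ln s / 2\<close> give \<open>(m + 1) * ln q \<ge> 4 * s\<close>, enough to
  beat \<open>8 * 2 ^ s\<close>. The ratio \<open>72 / 8 = 9\<close> gives
  \<open>(1 + 1 / q) ^ m \<le> exp (1 / 9) \<le> 9 / 8\<close>.\<close>

lemma fragment_parameters:
  fixes s :: nat
  assumes s: "s \<ge> 2" and q: "q = 72 * s / ln s" and m: "m = nat \<lfloor>8 * s / ln s\<rfloor>"
  shows "1 \<le> q" "8 * (2 ^ s * (1 / q) ^ (m + 1)) \<le> 1" "8 * ((1 + 1 / q) ^ m - 1) \<le> 1"
proof -
  have ln0: "ln (real s) > 0" using s by simp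
  \<comment> \<open>The estimate \<open>ln s \<le> 2 * sqrt s\<close> yields
    \<open>sqrt s \<le> q\<close>, the source of \<open>ln q \<ge> ln s / 2\<close>.\<close>
  have "ln (real s) = 2 * ln (sqrt s)" using s by (simp add: ln_sqrt)
  also have "\<dots> \<le> 2 * sqrt s" using ln_bound[of "sqrt s"] s by simp
  finally have "ln (real s) * sqrt s \<le> 2 * sqrt s * sqrt s" by (intro mult_right_mono) auto
  also have "2 * sqrt s * sqrt s = 2 * s" by (simp add: mult.assoc)
  finally have "ln (real s) * sqrt s \<le> 72 * s" by simp
  then have q_sqrt: "sqrt s \<le> q" unfolding q using ln0 by (simp add: field_simps)
  moreover have "1 \<le> sqrt s" using s by simp
  ultimately show q1: "1 \<le> q" by linarith
  have m_le: "m \<le> 8 * s / ln s" unfolding m using ln0 by (simp add: of_nat_nat)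
  have m_ge: "8 * s / ln s \<le> m + 1" unfolding m using ln0 by linarith
  have "4 * s = 8 * s / ln s * (ln s / 2)" using ln0 by simp
  also have "\<dots> \<le> (m + 1) * ln q"
  proof (rule mult_mono[OF m_ge])
    have "ln (sqrt s) \<le> ln q" using q_sqrt s q1 by simp
    then show "ln (real s) / 2 \<le> ln q" using s by (simp add: ln_sqrt)
  qed (use ln0 in auto)
  also have "\<dots> = ln (q ^ (m + 1))" using q1 by (subst ln_realpow) auto
  finally have 1: "4 * s \<le> ln (q ^ (m + 1))" by simp
  have "ln (8 * 2 ^ s :: real) = ln (2 ^ (s + 3))" by (simp add: power_add)
  also have "\<dots> = (s + 3) * ln 2" by (subst ln_realpow) auto
  also have "\<dots> \<le> real (s + 3) * 1" using ln_le_minus_one[of 2] by (intro mult_left_mono) auto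
  also have "\<dots> \<le> real (4 * s)" using s by simp
  also note 1
  finally have "(8 * 2 ^ s :: real) \<le> q ^ (m + 1)" using q1 by simp
  then show "8 * (2 ^ s * (1 / q) ^ (m + 1)) \<le> 1"
    using q1 by (simp add: power_divide divide_le_eq del: power_Suc)
  have "(1 + 1 / q) ^ m \<le> exp (1 / q) ^ m" using q1 by (intro power_mono exp_ge_add_one_self) auto
  also have "\<dots> = exp (m / q)" by (simp add: exp_of_nat_mult[symmetric])
  also have "\<dots> \<le> exp (1 / 9)"
  proof -
    have "m / q \<le> (8 * s / ln s) / q" using m_le q1 by (intro divide_right_mono) auto
    also have "\<dots> = 1 / 9" unfolding q using ln0 s by simp
    finally show ?thesis by simp
  qed
  also have "\<dots> \<le> 9 / 8"
  proof -
    have "8 / 9 \<le> exp (- (1 / 9 :: real))" using exp_ge_add_one_self[of "- (1 / 9)"] by simp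
    then show ?thesis by (simp add: exp_minus inverse_eq_divide field_simps)
  qed
  finally show "8 * ((1 + 1 / q) ^ m - 1) \<le> 1" by simp
qed

text \<open>A link that is spread with \<open>R = 4 * k * q\<close> is coloured with
  \<open>4 * k\<close> colours, which makes \<open>N * r\<close> equal to \<open>1 / q\<close>;
  hence \<open>288 = 4 * 72\<close>. A sunflower in the link lifts back to \<open>F\<close>.\<close>

lemma spread_bound:
  fixes k s :: nat
  assumes s: "s \<ge> 2" and k: "k \<ge> 1" and uni: "uniform_family s F" and free: "sunflower_free k F"
  shows "card F \<le> (288 * k * s / ln s) ^ s"
proof (rule ccontr)
  assume neg: "\<not> ?thesis"
  define q where "q = 72 * s / ln s"
  define m where "m = nat \<lfloor>8 * s / ln s\<rfloor>"
  define R where "R = real (4 * k) * q"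
  note params = fragment_parameters[OF s q_def m_def]
  have R: "R > 0" unfolding R_def using params(1) k by simp
  have "R ^ s < card F" using neg unfolding R_def q_def by (simp add: mult_ac)
  then obtain Z where Z: "Z \<subseteq> \<Union>F" "card Z < s" "link Z F \<noteq> {}"
    and spread: "\<And>Y. card {S \<in> link Z F. Y \<subseteq> S} \<le> (1 / R) ^ card Y * card (link Z F)"
    using ex_spread_link[OF uni R] by blast
  have finX: "finite (\<Union>F)" using uniform_familyD(1,2)[OF uni] by blast
  have L: "uniform_family (s - card Z) (link Z F)"
    using uniform_family_link[OF uni] finite_subset[OF Z(1) finX] by blast
  have NR: "real (4 * k) * (1 / R) = 1 / q" unfolding R_def using k params(1) by simp
  have "\<exists>B\<subseteq>link Z F. k_sunflower k B"
  proof (rule spread_imp_k_sunflower[where m = m, OF finX _ Z(3) _ _ _ refl k spread])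
    show "link Z F \<subseteq> Pow (\<Union>F)" unfolding link_def by blast
    show "{} \<notin> link Z F" using uniform_familyD(3)[OF L] Z(2) by force
    show "card S \<le> s" if "S \<in> link Z F" for S using uniform_familyD(3)[OF L that] by simp
    show "0 \<le> 1 / R" using R by simp
    show "real (4 * k) * (1 / R) \<le> 1" unfolding NR using params(1) by simp
    show "8 * (2 ^ s * (real (4 * k) * (1 / R)) ^ (m + 1)) \<le> 1" unfolding NR by (rule params(2))
    show "8 * ((1 + real (4 * k) * (1 / R)) ^ m - 1) \<le> 1" unfolding NR by (rule params(3))
  qed
  then show False using sunflower_free_link[OF free] unfolding sunflower_free_def by blast
qed

section \<open>Combining the two bounds for uniform families\<close>

lemma power_le_exp_fact: "(real n / exp 1) ^ n \<le> fact n"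
proof -
  have "real n ^ n / fact n = (\<Sum>i\<in>{n}. inverse (fact i) * real n ^ i)" by (simp add: field_simps)
  \<comment> \<open>One term of the exponential series is at most the whole sum.\<close>
  also have "\<dots> \<le> (\<Sum>i. inverse (fact i) * real n ^ i)"
    using summable_exp[of "real n"] by (intro sum_le_suminf) auto
  also have "\<dots> = exp (real n)" by (simp add: exp_def)
  also have "\<dots> = exp 1 ^ n" using exp_of_nat_mult[of n "1 :: real"] by simp
  finally show ?thesis by (simp add: power_divide field_simps)
qed

text \<open>Whichever term attains the minimum \<open>M\<close>, its own bound applies. In
  \<open>288 * exp 1\<close> the 288 comes from \<open>spread_bound\<close>, and
  \<open>exp 1\<close> pays for passing from \<open>s ^ s\<close> to \<open>fact s\<close>.\<close>

lemma uniform_family_threshold: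
  assumes k: "k \<ge> 2" and s: "s \<ge> 2" and uni: "uniform_family s F"
    and big: "sunflower_threshold (288 * exp 1) k s \<le> card F"
  shows "\<not> sunflower_free k F"
proof
  assume free: "sunflower_free k F"
  define x :: real where "x = 1 / (sqrt 10 - 2)"
  have sqrt: "3 < sqrt 10" "sqrt 10 < 4" by (auto intro: real_less_rsqrt real_less_lsqrt)
  have x: "x > 0" "x < 1" "1 \<le> 2 * x" unfolding x_def using sqrt by (auto simp: field_simps)
  have x2: "6 * x\<^sup>2 = 4 * x + 1"
  proof -
    define u :: real where "u = sqrt 10 - 2"
    have "u\<^sup>2 + 4 * u = 6" unfolding u_def by (simp add: power2_eq_square algebra_simps)
    moreover have "u > 0" unfolding u_def using sqrt by simp
    ultimately show ?thesis unfolding x_def u_def[symmetric]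
      by (simp add: field_simps power2_eq_square)
  qed
  define L where "L = ln (real (min k s))"
  define M where "M = min x (288 * exp 1 / L)"
  have T: "(k * M) ^ s * fact s / x\<^sup>2 \<le> card F"
    using big unfolding sunflower_threshold_def M_def L_def x_def by (simp add: field_simps)
  have xx: "0 < x\<^sup>2" "x\<^sup>2 < 1" using x by (auto simp: power_less_one_iff)
  show False
  proof (cases "M = x")
    case True
    show False
    \<comment> \<open>\<open>elementary_bound\<close> starts at \<open>k = 3\<close>. For
      \<open>k = 2\<close> any two distinct sets form a sunflower, and the threshold is at least
      4.\<close>
    proof (cases "k = 2")
      case True
      have "4 * x\<^sup>2 = (2 * x) ^ 2" by (simp add: power2_eq_square)
      also have "\<dots> \<le> (2 * x) ^ s" using x s by (intro power_increasing) auto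
      finally have "4 * x\<^sup>2 * 1 \<le> (2 * x) ^ s * fact s" using x by (intro mult_mono) auto
      then have "4 \<le> (2 * x) ^ s * fact s / x\<^sup>2" using xx by (simp add: field_simps)
      then have "2 \<le> card F" using T \<open>M = x\<close> True by simp
      then obtain B where B: "B \<subseteq> F" "card B = 2" "finite B" by (rule obtain_subset_with_card_n)
      then obtain U V where UV: "B = {U, V}" "U \<noteq> V" by (meson card_2_iff)
      then have "sunflower_with_core B (U \<inter> V)" unfolding sunflower_with_core_def by auto
      then have "k_sunflower k B" using B True unfolding k_sunflower_def sunflower_def by blast
      then show False using free B(1) unfolding sunflower_free_def by blast
    next
      case False
      then have "card F < (k * x) ^ s * fact s / x\<^sup>2"
        using k by (intro elementary_bound[OF _ x(1) x2 uni free]) simp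
      then show False using T \<open>M = x\<close> by simp
    qed
  next
    case False
    then have M: "M = 288 * exp 1 / L" unfolding M_def by (simp add: min_def split: if_splits)
    have L: "0 < L" "L \<le> ln s" unfolding L_def using k s by auto
    define b where "b = (288 * k * s / ln s) ^ s"
    have "b = (k * (288 * exp 1 / ln s)) ^ s * (s / exp 1) ^ s"
      unfolding b_def power_mult_distrib[symmetric] by (simp add: mult_ac)
    also have "\<dots> \<le> (k * M) ^ s * fact s"
      unfolding M using L by (intro mult_mono power_mono power_le_exp_fact mult_left_mono divide_left_mono) auto
    finally have "b / x\<^sup>2 \<le> card F" using T xx by (smt (verit) divide_right_mono)
    moreover have "b > 0" unfolding b_def using k s by simp
    \<comment> \<open>\<open>spread_bound\<close> is not strict; \<open>x < 1\<close> supplies the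
      strictness needed for the contradiction.\<close>
    then have "b < b / x\<^sup>2" using xx by (simp add: field_simps)
    moreover have "card F \<le> b" unfolding b_def using spread_bound[OF s _ uni free] k by simp
    ultimately show False by linarith
  qed
qed

section \<open>Padding and change of the type of points\<close>

text \<open>The sum type provides fresh points even if \<open>'a\<close> is finite. Tagging them
  with \<open>U\<close> keeps them private to one padded set, and \<open>vimage Inl\<close> removes
  them again.\<close>

definition pad :: "nat \<Rightarrow> 'a set \<Rightarrow> ('a + 'a set \<times> nat) set" where
  "pad s U = Inl ` U \<union> (\<lambda>i. Inr (U, i)) ` {..<s - card U}"

lemma vimage_Inl_pad: "Inl -` pad s U = U"
  unfolding pad_def by auto

lemma card_pad:
  assumes "finite U" "card U \<le> s"
  shows "finite (pad s U)" "card (pad s U) = s"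
proof -
  show "finite (pad s U)" unfolding pad_def using assms by simp
  have "card (pad s U) = card (Inl ` U :: ('a + 'a set \<times> nat) set)
      + card ((\<lambda>i. Inr (U, i)) ` {..<s - card U} :: ('a + 'a set \<times> nat) set)"
    unfolding pad_def using assms by (intro card_Un_disjoint) auto
  also have "\<dots> = card U + (s - card U)" by (simp add: card_image inj_on_def)
  finally show "card (pad s U) = s" using assms by simp
qed

lemma finite_family_threshold:
  assumes "k \<ge> 2" "s \<ge> 2" "finite F" and F: "\<forall>U\<in>F. finite U \<and> card U \<le> s"
    and big: "sunflower_threshold (288 * exp 1) k s \<le> card F"
  shows "\<exists>B\<subseteq>F. k_sunflower k B"
proof -
  have "inj_on (pad s) F" by (rule inj_on_inverseI) (rule vimage_Inl_pad)
  then have "card (pad s ` F) = card F" by (rule card_image)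
  moreover have "uniform_family s (pad s ` F)"
    unfolding uniform_family_def using assms(3) F by (auto simp: card_pad)
  ultimately have "\<not> sunflower_free k (pad s ` F)"
    using uniform_family_threshold[OF assms(1,2)] big by metis
  then obtain B where "B \<subseteq> pad s ` F" "k_sunflower k B" unfolding sunflower_free_def by blast
  then obtain B' where "B' \<subseteq> F" "k_sunflower k B'"
    by (rule k_sunflower_pullback[where g = "vimage Inl"]) (auto simp: vimage_Inl_pad)
  then show ?thesis by blast
qed

text \<open>An infinite family has finite subfamilies of every size, in particular one that reaches
  the threshold, so finite families suffice.\<close>

lemma sunflower_constantI:
  assumes "\<And>k s (F :: 'a set set). k \<ge> 2 \<Longrightarrow> s \<ge> 2 \<Longrightarrow> finite F \<Longrightarrow> \<forall>U\<in>F. finite U \<and> card U \<le> s \<Longrightarrow>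
    sunflower_threshold c k s \<le> card F \<Longrightarrow> \<exists>B\<subseteq>F. k_sunflower k B"
  shows "sunflower_constant TYPE('a) c"
  unfolding sunflower_constant_def
proof (intro allI impI)
  fix k s :: nat and X :: "'a set" and F :: "'a set set"
  assume ks: "k \<ge> 2" "s \<ge> 2" and F: "\<forall>U\<in>F. finite U \<and> card U \<le> s"
    and big: "infinite F \<or> sunflower_threshold c k s \<le> real (card F)"
  obtain G where G: "finite G" "G \<subseteq> F" "sunflower_threshold c k s \<le> card G"
  proof (cases "finite F")
    case True
    then show thesis using that big by blast
  next
    case False
    then obtain G where "finite G" "card G = nat \<lceil>sunflower_threshold c k s\<rceil>" "G \<subseteq> F"
      using infinite_arbitrarily_large by blast
    then show thesis using that real_nat_ceiling_ge by metis
  qed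
  have "\<forall>U\<in>G. finite U \<and> card U \<le> s" using F G(2) by blast
  then show "\<exists>B\<subseteq>F. k_sunflower k B" using assms[OF ks G(1) _ G(3)] G(2) by blast
qed

text \<open>The union of a finite family of finite sets can be numbered injectively by
  \<open>f\<close>. The relabelled family has as many sets, none larger than before, and its
  sunflowers pull back along \<open>g\<close>, whatever \<open>c\<close> is.\<close>

lemma sunflower_constant_transfer:
  assumes "sunflower_constant TYPE(nat) c"
  shows "sunflower_constant TYPE('a) c"
proof (rule sunflower_constantI)
  fix k s :: nat and F :: "'a set set"
  assume ks: "k \<ge> 2" "s \<ge> 2" and F: "finite F" "\<forall>U\<in>F. finite U \<and> card U \<le> s"
    and big: "sunflower_threshold c k s \<le> card F"
  have "finite (\<Union>F)" using F by blast
  then obtain f :: "'a \<Rightarrow> nat" where f: "inj_on f (\<Union>F)"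
    using finite_imp_inj_to_nat_seg by blast
  define g where "g V = \<Union>F \<inter> f -` V" for V
  have gf: "g (f ` U) = U" if "U \<in> F" for U
  proof -
    have "U \<subseteq> \<Union>F" using that by blast
    then show ?thesis unfolding g_def using inj_on_image_mem_iff[OF f _ \<open>U \<subseteq> \<Union>F\<close>] by auto
  qed
  have gInt: "g V \<inter> g W = g (V \<inter> W)" for V W unfolding g_def by blast
  have "card (image f ` F) = card F"
    using gf by (intro card_image inj_on_inverseI[of _ g]) auto
  then have "infinite (image f ` F) \<or> sunflower_threshold c k s \<le> card (image f ` F)" using big by simp
  moreover have "\<forall>V\<in>image f ` F. finite V \<and> card V \<le> s"
    using F(2) by (auto intro: le_trans[OF card_image_le])
  ultimately obtain B where "B \<subseteq> image f ` F" "k_sunflower k B"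
    using assms ks unfolding sunflower_constant_def by (metis Pow_UNIV subset_UNIV)
  then obtain B' where "B' \<subseteq> F" "k_sunflower k B'"
    by (rule k_sunflower_pullback[where g = g]) (simp_all add: gf gInt)
  then show "\<exists>B\<subseteq>F. k_sunflower k B" by blast
qed

theorem theorem1p2:
  "(\<exists>c>0. sunflower_constant TYPE(nat) c) \<and>
   (\<forall>c>0. sunflower_constant TYPE(nat) c \<longrightarrow> sunflower_constant TYPE('a) c)"
proof (intro conjI allI impI)
  have "sunflower_constant TYPE(nat) (288 * exp 1)"
    by (rule sunflower_constantI) (rule finite_family_threshold)
  then show "\<exists>c>0. sunflower_constant TYPE(nat) c" by (intro exI[of _ "288 * exp 1"]) simp
qed (rule sunflower_constant_transfer)

end
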